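(* Let $a$ be a positive integer such that $a$ is a primitive root modulo $p$ for infinitely many primes $p$, and let $S = \{a^k : k \in \mathbb{N}\}$. Let $f: \mathbb{N} \to \mathbb{Z}_{\geq 0}$ be non-decreasing and unbounded. Then there exists a subset $A \subseteq S$ such that $|A \cap \{1, \dots, N\}| \leq f(N)$ for all $N \in \mathbb{N}$ and such that there does not exist an $n \in \mathbb{Z}$ with $A + n = \{x + n : x \in A\}$ contained in the set of (positive) primes. In particular, there is no non-decreasing, unbounded function $f: \mathbb{N} \to \mathbb{Z}_{\geq 0}$ with the property that every admissible set $A \subseteq \mathbb{N}$ satisfying $|A \cap \{1, \dots, N\}| \leq f(N)$ for all $N$ admits some $n \in \mathbb{Z}$ such that $A + n$ is contained in the primes.
   Context: $\mathbb{N}$ denotes the positive integers. A set $A \subseteq \mathbb{N}$ is called admissible if there is no prime $p$ such that $A$ contains at least one element in each residue class modulo $p$. Primes are taken to be positive. An integer $a$ is a primitive root modulo a prime $p$ if its residue generates the multiplicative group $(\mathbb{Z}/p\mathbb{Z})^\times$. (It is a known result that at least one positive integer $a$ is a primitive root modulo infinitely many primes.) *)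

theory Defs
  imports "HOL-Number_Theory.Number_Theory"
begin

(* Here r ranges over all naturals, which represent every residue class modulo p. *)
definition admissible :: "nat set \<Rightarrow> bool" where
  "admissible A \<longleftrightarrow> \<not> (\<exists>p. prime p \<and> (\<forall>r. \<exists>x\<in>A. [x = r] (mod p)))"

(* The positive integers are rendered as {1..} within nat, so the value f 0 is irrelevant. *)
definition nondecreasing_unbounded :: "(nat \<Rightarrow> nat) \<Rightarrow> bool" where
  "nondecreasing_unbounded f \<longleftrightarrow> mono_on {1..} f \<and> \<not> bdd_above (f ` {1..})"

definition counting_bounded_by :: "nat set \<Rightarrow> (nat \<Rightarrow> nat) \<Rightarrow> bool" where
  "counting_bounded_by A f \<longleftrightarrow> (\<forall>N\<ge>1. card (A \<inter> {1..N}) \<le> f N)"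

(* Shifts may be negative, so the translate is taken in int, where prime q implies q > 0. *)
definition has_prime_translate :: "nat set \<Rightarrow> bool" where
  "has_prime_translate A \<longleftrightarrow> (\<exists>n::int. (\<lambda>x. int x + n) ` A \<subseteq> {q::int. prime q})"

end

theory Submission
  imports Defs "HOL-Library.Nat_Bijection"
begin

text \<open>
  Enumerate the shifts as n_0, n_1, ... and, for each i, pick an element x_i with x_i + n_i not
  prime, so large that f is at least i + 1 from x_i on; then the set of all x_i satisfies the
  counting bound and has no prime translate. Such x_i exist among the powers of any a > 1: if
  q = a^k + n is a prime not dividing a, then q divides a^(k + q - 1) + n by Fermat. The
  last claim does not need Artin-type results: taking x_i to be a multiple of (i + 2)!, the
  set occupies at most p - 1 classes modulo each prime p.
\<close>

text \<open>If \<open>x i\<close> \<le> N, then the threshold \<open>B i\<close> is \<le> N as well,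
  so i < \<open>f (B i)\<close> \<le> \<open>f N\<close>: only indices below \<open>f N\<close>
  contribute elements up to N. Keeping \<open>Q\<close> abstract lets the powers of a and the
  multiples of factorials share this argument.\<close>

lemma sparse_choice:
  assumes f: "nondecreasing_unbounded f"
    and Q: "\<And>i B. \<exists>y\<ge>B. Q i y"
  obtains x :: "nat \<Rightarrow> nat"
    where "\<forall>i. Q i (x i) \<and> x i \<ge> 1" "counting_bounded_by (range x) f"
proof -
  have mono: "f M \<le> f N" if "1 \<le> M" "M \<le> N" for M N
    using f that by (auto simp: nondecreasing_unbounded_def mono_on_def)
  \<comment> \<open>Thresholds start at 1 because \<open>f\<close> is monotone only on the positive
    integers; this also makes every \<open>x i\<close> positive.\<close>
  have "\<exists>B\<ge>1. f B > i" for i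
    using f by (force simp: nondecreasing_unbounded_def bdd_above_def not_le)
  then obtain B where B: "\<And>i. B i \<ge> 1" "\<And>i. f (B i) > i" by metis
  have "\<forall>i. \<exists>y. y \<ge> B i \<and> Q i y" using Q by blast
  from choice[OF this] obtain x where x: "\<And>i. x i \<ge> B i" "\<And>i. Q i (x i)" by blast
  have "card (range x \<inter> {1..N}) \<le> f N" for N
  proof -
    have "range x \<inter> {1..N} \<subseteq> x ` {..<f N}"
    proof
      fix y assume "y \<in> range x \<inter> {1..N}"
      then obtain i where i: "y = x i" "x i \<le> N" by auto
      then have "f (B i) \<le> f N" using B x mono by (meson order_trans)
      then show "y \<in> x ` {..<f N}" using i B(2)[of i] by auto
    qed
    then show ?thesis
      by (metis card_lessThan card_image_le card_mono finite_imageI finite_lessThan order_trans)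
  qed
  then show thesis
    using that[of x] x order_trans[OF B(1) x(1)] by (simp add: counting_bounded_by_def)
qed

text \<open>Diagonal argument: \<open>int_decode\<close> enumerates all integers, so each shift n is
  defeated by the element of index \<open>int_encode n\<close>.\<close>

lemma no_prime_translate:
  assumes "\<And>i. \<not> prime (int (x i) + int_decode i)"
  shows "\<not> has_prime_translate (range x)"
proof
  assume "has_prime_translate (range x)"
  then obtain n where "(\<lambda>y. int y + n) ` range x \<subseteq> {q. prime q}"
    unfolding has_prime_translate_def by blast
  then have "prime (int (x i) + n)" for i by blast
  then show False using assms[of "int_encode n"] by simp
qed

lemma not_prime_if_proper_dvd:
  fixes q m :: int
  assumes "prime q" "q dvd m" "q < m"
  shows "\<not> prime m"
  using assms primes_dvd_imp_eq by blast

lemma power_shift_not_prime: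
  fixes a B :: nat and n :: int
  assumes a: "a > 1"
  shows "\<exists>k\<ge>1. a ^ k \<ge> B \<and> \<not> prime (int (a ^ k) + n)"
proof -
  \<comment> \<open>Since k < a^k, this choice gives a^k \<ge> B and a^k + n > a, so a prime value
    of a^k + n cannot divide a.\<close>
  define k where "k = B + a + nat \<bar>n\<bar> + 1"
  have "k < a ^ k" using a by (simp add: power_gt_expt)
  then have large: "int (a ^ k) > int B + int a + \<bar>n\<bar>"
    unfolding k_def by linarith
  show ?thesis
  proof (cases "prime (int (a ^ k) + n)")
    case False
    moreover have "B \<le> a ^ k" using large by linarith
    moreover have "k \<ge> 1" by (simp add: k_def)
    ultimately show ?thesis by blast
  next
    case True
    define q where "q = nat (int (a ^ k) + n)"
    have q: "int q = int (a ^ k) + n" using large by (simp add: q_def)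
    have "prime q" using True q by (metis prime_int_nat_transfer nat_int prime_nat_int_transfer)
    have "a < q" using large q by linarith
    then have "\<not> q dvd a" using a by (auto dest: dvd_imp_le)
    then have "[a ^ (q - 1) = 1] (mod q)" using \<open>prime q\<close> fermat_theorem by blast
    then have "[a ^ (k + (q - 1)) = a ^ k] (mod q)"
      by (metis cong_scalar_left mult.right_neutral power_add)
    then have "[int (a ^ (k + (q - 1))) + n = int (a ^ k) + n] (mod int q)"
      by (metis cong_add cong_int_iff cong_refl)
    then have dvd: "int q dvd int (a ^ (k + (q - 1))) + n"
      by (metis cong_dvd_iff dvd_refl q)
    have gt: "a ^ k < a ^ (k + (q - 1))"
      using a prime_gt_1_nat[OF \<open>prime q\<close>] by (intro power_strict_increasing) auto
    then have "int q < int (a ^ (k + (q - 1))) + n" using q by linarith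
    then have "\<not> prime (int (a ^ (k + (q - 1))) + n)"
      using not_prime_if_proper_dvd dvd True q by metis
    moreover have "a ^ (k + (q - 1)) \<ge> B" using gt large by linarith
    moreover have "k + (q - 1) \<ge> 1" by (simp add: k_def)
    ultimately show ?thesis by blast
  qed
qed

text \<open>If q = y + n is prime, moving from y to y + M * q preserves divisibility by M and
  multiplies the shifted value by M + 1, which makes it composite.\<close>

lemma multiple_shift_not_prime:
  fixes M B :: nat and n :: int
  assumes M: "M > 0"
  shows "\<exists>y\<ge>B. M dvd y \<and> \<not> prime (int y + n)"
proof -
  define y where "y = M * (B + nat \<bar>n\<bar> + 1)"
  have "1 * (B + nat \<bar>n\<bar> + 1) \<le> y" unfolding y_def using M by (intro mult_right_mono) auto
  then have "B + nat \<bar>n\<bar> + 1 \<le> y" by (simp only: mult_1)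
  then have large: "B \<le> y" "int y + n > 0" by linarith+
  show ?thesis
  proof (cases "prime (int y + n)")
    case False
    then show ?thesis using large by (intro exI[of _ y]) (auto simp: y_def)
  next
    case True
    define q where "q = nat (int y + n)"
    have q: "int q = int y + n" using large by (simp add: q_def)
    have "q > 0" using q large by simp
    have eq: "int (y + M * q) + n = int q * (int M + 1)"
      using q by (simp add: algebra_simps)
    have "int q < int (y + M * q) + n" using q M \<open>q > 0\<close> by simp
    then have "\<not> prime (int (y + M * q) + n)"
      using not_prime_if_proper_dvd[of "int q"] True q eq by (metis dvd_triv_left)
    then show ?thesis using large by (intro exI[of _ "y + M * q"]) (auto simp: y_def)
  qed
qed

lemma admissible_range_fact_dvd:
  assumes x: "\<And>i. fact (i + 2) dvd x i"
  shows "admissible (range x)"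
  unfolding admissible_def
proof
  assume "\<exists>p. prime p \<and> (\<forall>r. \<exists>y\<in>range x. [y = r] (mod p))"
  then obtain p where p: "prime p" and all: "\<And>r. \<exists>i. [x i = r] (mod p)" by auto
  have "p \<ge> 2" using p by (rule prime_ge_2_nat)
  \<comment> \<open>All indices i \<ge> p - 2 fall into class 0, as p divides
    \<open>fact (i + 2)\<close>. The offset 2 matters: it leaves p - 2 other indices, hence at most
    p - 1 classes; an offset of 1 would only give the bound p.\<close>
  let ?R = "insert 0 ((\<lambda>i. x i mod p) ` {..<p - 2})"
  have "{..<p} \<subseteq> ?R"
  proof
    fix r assume "r \<in> {..<p}"
    then obtain i where i: "r = x i mod p" using all[of r] by (auto simp: cong_def)
    show "r \<in> ?R"
    proof (cases "i < p - 2")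
      case True
      then show ?thesis using i by auto
    next
      case False
      then have "p dvd fact (i + 2)" using \<open>p \<ge> 2\<close> by (intro dvd_fact) auto
      then show ?thesis using i x[of i] by (metis dvd_imp_mod_0 dvd_trans insertI1)
    qed
  qed
  then have "p \<le> card ?R" by (metis card_lessThan card_mono finite_imageI finite_insert finite_lessThan)
  also have "\<dots> \<le> Suc (card {..<p - 2})"
    by (metis Suc_le_mono card_image_le card_insert_if finite_imageI
        finite_lessThan le_SucI)
  finally show False using \<open>p \<ge> 2\<close> by simp
qed

text \<open>The order of 1 is 1, which forces p - 1 = 1.\<close>

lemma residue_primroot_1_prime:
  assumes "prime p" "residue_primroot p 1"
  shows "p = 2"
proof -
  have "totient p = 1" using assms(2) by (simp add: residue_primroot_def)
  then show ?thesis using assms(1) by (simp add: totient_prime)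
qed

theorem theorem1:
  shows "(\<forall>(a::nat) (f :: nat \<Rightarrow> nat).
            a > 0 \<and> infinite {p. prime p \<and> residue_primroot p a} \<and> nondecreasing_unbounded f
            \<longrightarrow> (\<exists>A \<subseteq> {a ^ k |k::nat. k \<ge> 1}.
                  counting_bounded_by A f \<and> \<not> has_prime_translate A))
       \<and> \<not> (\<exists>f :: nat \<Rightarrow> nat. nondecreasing_unbounded f
              \<and> (\<forall>A \<subseteq> {1..}. admissible A \<and> counting_bounded_by A f
                     \<longrightarrow> has_prime_translate A))"
proof (intro conjI allI impI notI; (elim conjE exE)?)
  fix a :: nat and f :: "nat \<Rightarrow> nat"
  assume "a > 0" and inf: "infinite {p. prime p \<and> residue_primroot p a}"
    and f: "nondecreasing_unbounded f"
  \<comment> \<open>For a = 1 the only power is 1, which the shift by 1 sends to the prime 2, so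
    this case has to be excluded.\<close>
  have "a \<noteq> 1"
  proof
    assume "a = 1"
    then have "{p. prime p \<and> residue_primroot p a} \<subseteq> {2}" using residue_primroot_1_prime by blast
    then show False using inf finite_subset by blast
  qed
  with \<open>a > 0\<close> have a: "a > 1" by simp
  define Q where "Q = (\<lambda>i y. y \<in> {a ^ k |k::nat. k \<ge> 1} \<and> \<not> prime (int y + int_decode i))"
  have "\<exists>y\<ge>B. Q i y" for i B
    using power_shift_not_prime[OF a, of B "int_decode i"] unfolding Q_def by blast
  then obtain x where Qx: "\<forall>i. Q i (x i) \<and> x i \<ge> 1"
    and count: "counting_bounded_by (range x) f"
    by (rule sparse_choice[OF f, of Q])
  have x: "x i \<in> {a ^ k |k::nat. k \<ge> 1}" "\<not> prime (int (x i) + int_decode i)" for i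
    using Qx unfolding Q_def by blast+
  have "range x \<subseteq> {a ^ k |k::nat. k \<ge> 1}" using x by blast
  moreover have "\<not> has_prime_translate (range x)" using x(2) by (rule no_prime_translate)
  ultimately show "\<exists>A \<subseteq> {a ^ k |k::nat. k \<ge> 1}.
      counting_bounded_by A f \<and> \<not> has_prime_translate A"
    using count by blast
next
  fix f :: "nat \<Rightarrow> nat"
  assume f: "nondecreasing_unbounded f"
    and all: "\<forall>A \<subseteq> {1..}. admissible A \<and> counting_bounded_by A f \<longrightarrow> has_prime_translate A"
  define Q where "Q = (\<lambda>i y. fact (i + 2) dvd y \<and> \<not> prime (int y + int_decode i))"
  have "\<exists>y\<ge>B. Q i y" for i B
    using multiple_shift_not_prime[of "fact (i + 2)" B "int_decode i"] unfolding Q_def by simp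
  then obtain x where Qx: "\<forall>i. Q i (x i) \<and> x i \<ge> 1"
    and count: "counting_bounded_by (range x) f"
    by (rule sparse_choice[OF f, of Q])
  have x: "fact (i + 2) dvd x i" "\<not> prime (int (x i) + int_decode i)" for i
    using Qx unfolding Q_def by blast+
  have "admissible (range x)" using x(1) by (rule admissible_range_fact_dvd)
  \<comment> \<open>Divisibility by factorials alone would allow 0; the bound
    \<open>x i \<ge> 1\<close> rules it out.\<close>
  moreover have "range x \<subseteq> {1..}" using Qx by auto
  moreover have "\<not> has_prime_translate (range x)" using x(2) by (rule no_prime_translate)
  ultimately show False using all count by blast
qed

end
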